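(* The Graphical Traveling Salesperson Problem has no mixed-integer programming formulation whose only integer variables are the edge variables $x_e$, $e \in E$. More precisely: it is not true that for every finite graph $G=(V,E)$ there exist $q \in \mathbb{Z}_{\geq 0}$, a matrix $A$, a matrix $B$ and a vector $d$ such that the set $Q = \{ (x,y) \in \mathbb{Z}^E \times \mathbb{R}^q : Ax + By \leq d \}$ has as its projection onto the $x$-variables exactly the set of feasible GTSP solutions $F(G)$.
   Context: Let $G=(V,E)$ be a finite graph. For $S \subseteq V$ let $\delta(S) = \{ e \in E : |e \cap S| = 1\}$ and $\delta(v) = \delta(\{v\})$. The set of feasible solutions of the Graphical Traveling Salesperson Problem (GTSP) on $G$ is $F(G) = \{ x \in \mathbb{Z}_{\geq 0}^E : \sum_{e \in \delta(S)} x_e \geq 2 \text{ for all } \varnothing \neq S \subsetneq V, \text{ and } \sum_{e \in \delta(v)} x_e \text{ is even for all } v \in V\}$; $x_e$ indicates how often edge $e$ is traversed by a tour visiting every node at least once (i.e. the multi-subgraph with $x_e$ copies of $e$ is spanning, connected and Eulerian). Given costs $c \in \mathbb{R}^E$, the GTSP asks to minimize $c^\top x$ over $x \in F(G)$. A mixed-integer programming formulation with integrality only on the $x$-variables is a set $Q = \{ (x,y) \in \mathbb{Z}^E \times \mathbb{R}^q : Ax + By \leq d \}$ (with $A,B,d$ real of appropriate dimensions) whose projection onto the $x$-coordinates equals $F(G)$, so that $\min\{c^\top x : (x,y) \in Q\}$ is equivalent to the GTSP. *)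

theory Defs
  imports Complex_Main "HOL-Library.FuncSet"
begin

definition finite_graph :: "'v set \<Rightarrow> 'v set set \<Rightarrow> bool" where
  "finite_graph V E \<longleftrightarrow> finite V \<and> (\<forall>e\<in>E. e \<subseteq> V \<and> card e = 2)"

definition cut_edges :: "'v set set \<Rightarrow> 'v set \<Rightarrow> 'v set set" where
  "cut_edges E S = {e \<in> E. card (e \<inter> S) = 1}"

text \<open>Vectors indexed by a finite set are extensional functions on that index set, so that
  equality of vectors is equality of functions.\<close>

definition gtsp_feasible :: "'v set \<Rightarrow> 'v set set \<Rightarrow> ('v set \<Rightarrow> int) set" where
  "gtsp_feasible V E = {x \<in> E \<rightarrow>\<^sub>E {0..}.
     (\<forall>S. S \<noteq> {} \<and> S \<subset> V \<longrightarrow> (\<Sum>e\<in>cut_edges E S. x e) \<ge> 2) \<and>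
     (\<forall>v\<in>V. even (\<Sum>e\<in>cut_edges E {v}. x e))}"

text \<open>The system \<open>A x + B y \<le> d\<close> has rows indexed by \<open>{..<m}\<close>; the columns of \<open>A\<close> are indexed by
  the edges and those of \<open>B\<close> by \<open>{..<q}\<close>.  Entries of \<open>A\<close>, \<open>B\<close>, \<open>d\<close> outside these ranges are
  never used.\<close>

definition mip_set :: "'e set \<Rightarrow> nat \<Rightarrow> nat \<Rightarrow> (nat \<Rightarrow> 'e \<Rightarrow> real) \<Rightarrow> (nat \<Rightarrow> nat \<Rightarrow> real) \<Rightarrow>
    (nat \<Rightarrow> real) \<Rightarrow> (('e \<Rightarrow> int) \<times> (nat \<Rightarrow> real)) set" where
  "mip_set E q m A B d = {(x, y). x \<in> E \<rightarrow>\<^sub>E UNIV \<and> y \<in> {..<q} \<rightarrow>\<^sub>E UNIV \<and>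
     (\<forall>i<m. (\<Sum>e\<in>E. A i e * real_of_int (x e)) + (\<Sum>j<q. B i j * y j) \<le> d i)}"

end

theory Submission
  imports Defs
begin

text \<open>The projection of a mixed-integer set onto its integer variables consists of all integer
  points of a convex set, so it contains every integral midpoint of two of its members. The parity
  constraints violate this already on a single edge, whose feasible multiplicities are
  \<open>2, 4, 6, \<dots>\<close>: the midpoint of 2 and 4 is odd.\<close>

lemma midpoint_in_fst_mip_set:
  assumes "x \<in> fst ` mip_set E q m A B d" and "x' \<in> fst ` mip_set E q m A B d"
    and z: "z \<in> E \<rightarrow>\<^sub>E UNIV" "\<And>e. e \<in> E \<Longrightarrow> 2 * z e = x e + x' e"
  shows "z \<in> fst ` mip_set E q m A B d"
proof -
  obtain y y' where y: "(x, y) \<in> mip_set E q m A B d" and y': "(x', y') \<in> mip_set E q m A B d"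
    using assms(1,2) by auto
  \<comment> \<open>The continuous variables carry no integrality constraint, so averaging the two
    witnesses is allowed; \<open>restrict\<close> makes the average extensional, as
    \<open>mip_set\<close> demands.\<close>
  define w where "w = restrict (\<lambda>j. (y j + y' j) / 2) {..<q}"
  have "(\<Sum>e\<in>E. A i e * real_of_int (z e)) + (\<Sum>j<q. B i j * w j) \<le> d i" if "i < m" for i
  proof -
    have real_z: "2 * real_of_int (z e) = real_of_int (x e) + real_of_int (x' e)" if "e \<in> E" for e
      using z(2)[OF that] by linarith
    have "2 * (\<Sum>e\<in>E. A i e * real_of_int (z e)) =
        (\<Sum>e\<in>E. A i e * (2 * real_of_int (z e)))"
      by (simp add: sum_distrib_left algebra_simps)
    also have "\<dots> = (\<Sum>e\<in>E. A i e * real_of_int (x e)) + (\<Sum>e\<in>E. A i e * real_of_int (x' e))"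
      by (simp add: real_z distrib_left sum.distrib)
    finally have sum_z: "2 * (\<Sum>e\<in>E. A i e * real_of_int (z e)) = \<dots>" .
    have "2 * (\<Sum>j<q. B i j * w j) = (\<Sum>j<q. B i j * y j + B i j * y' j)"
      unfolding sum_distrib_left by (rule sum.cong) (auto simp: w_def algebra_simps)
    then have sum_w: "2 * (\<Sum>j<q. B i j * w j) = (\<Sum>j<q. B i j * y j) + (\<Sum>j<q. B i j * y' j)"
      by (simp add: sum.distrib)
    \<comment> \<open>The sum of these two rows is twice row \<open>i\<close> at
      \<open>(z, w)\<close>, bounded by \<open>2 * d i\<close>.\<close>
    have "(\<Sum>e\<in>E. A i e * real_of_int (x e)) + (\<Sum>j<q. B i j * y j) \<le> d i"
      "(\<Sum>e\<in>E. A i e * real_of_int (x' e)) + (\<Sum>j<q. B i j * y' j) \<le> d i"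
      using y y' that by (auto simp: mip_set_def)
    then show ?thesis using sum_z sum_w by linarith
  qed
  then have "(z, w) \<in> mip_set E q m A B d"
    using z(1) by (simp add: mip_set_def w_def)
  then show ?thesis by force
qed

text \<open>The only nonempty proper subsets of \<open>{u, v}\<close> are the two singletons, and
  the cut of each is the whole edge set, so every cut sum and every degree equals
  \<open>k\<close>.\<close>

lemma gtsp_feasible_single_edge_iff:
  assumes "u \<noteq> v"
  shows "(\<lambda>e\<in>{{u, v}}. k) \<in> gtsp_feasible {u, v} {{u, v}} \<longleftrightarrow> k \<ge> 2 \<and> even k"
proof -
  have cut: "cut_edges {{u, v}} {u} = {{u, v}}" "cut_edges {{u, v}} {v} = {{u, v}}"
    using assms by (auto simp: cut_edges_def)
  have proper: "S \<noteq> {} \<and> S \<subset> {u, v} \<longleftrightarrow> S = {u} \<or> S = {v}" for S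
    using assms by auto
  show ?thesis
    unfolding gtsp_feasible_def proper by (auto simp: cut)
qed

theorem theorem1:
  "\<not> (\<forall>(V :: nat set) E. finite_graph V E \<longrightarrow>
        (\<exists>q m A B d. fst ` mip_set E q m A B d = gtsp_feasible V E))"
proof
  \<comment> \<open>As edges are two-element sets, \<open>?V\<close> is both the vertex set and the
    only edge.\<close>
  let ?V = "{0, 1} :: nat set"
  let ?x = "\<lambda>k::int. \<lambda>e\<in>{?V}. k"
  assume "\<forall>(V :: nat set) E. finite_graph V E \<longrightarrow>
        (\<exists>q m A B d. fst ` mip_set E q m A B d = gtsp_feasible V E)"
  moreover have "finite_graph ?V {?V}"
    by (simp add: finite_graph_def)
  ultimately obtain q m A B d where Q: "fst ` mip_set {?V} q m A B d = gtsp_feasible ?V {?V}"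
    by blast
  have feasible_iff: "?x k \<in> gtsp_feasible ?V {?V} \<longleftrightarrow> k \<ge> 2 \<and> even k" for k
    by (rule gtsp_feasible_single_edge_iff) simp
  have "?x 2 \<in> gtsp_feasible ?V {?V}" "?x 4 \<in> gtsp_feasible ?V {?V}"
    unfolding feasible_iff by simp_all
  \<comment> \<open>By \<open>Q\<close> both points lie in the projection, and
    \<open>2 * 3 = 2 + 4\<close> on the only edge.\<close>
  then have "?x 3 \<in> gtsp_feasible ?V {?V}"
    unfolding Q[symmetric] by (rule midpoint_in_fst_mip_set) auto
  then show False
    unfolding feasible_iff by simp
qed

end
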